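(* Let $\mathbb{H}$ be an infinite-dimensional separable real Hilbert space and let $A$ be a positive bounded linear operator on $\mathbb{H}$. Suppose $B_{\mathbb{H}(A)}\cap\overline{R(A)}$ is bounded with respect to $\|\cdot\|$ and $\dim\overline{R(A)}=\infty$. Let $\epsilon\in[0,1)$ and let $T\in B_{A^{1/2}}(\mathbb{H})$ be a compact operator. Then $T$ is $(\epsilon,A)$-approximate right symmetric in the sense of Chmieliński if and only if $\|T\|_A=0$.
   Context: $\|\cdot\|$ is the Hilbert space norm of $\mathbb{H}$; compactness is with respect to it. A bounded linear operator $A$ on $\mathbb{H}$ is positive if $A=A^*$ and $\langle Ax,x\rangle\ge0$ for all $x$; $R(A)$ is its range and the closure $\overline{R(A)}$ is in $\|\cdot\|$. Put $\langle x,y\rangle_A=\langle Ax,y\rangle$, $\|x\|_A=\sqrt{\langle Ax,x\rangle}$, $B_{\mathbb{H}(A)}=\{x\in\mathbb{H}:\|x\|_A\le1\}$. $B_{A^{1/2}}(\mathbb{H})$ is the set of $A$-bounded operators, i.e. bounded linear operators $T$ on $\mathbb{H}$ for which there is $c>0$ with $\|Tx\|_A\le c\|x\|_A$ for all $x\in\mathbb{H}$; for such $T$, $\|T\|_A=\sup\{\|Tx\|_A:\|x\|_A=1\}$. For $T,S\in B_{A^{1/2}}(\mathbb{H})$, $T\bot_{\epsilon(A)}S$ means $\|T+\lambda S\|_A^2\ge\|T\|_A^2-2\epsilon\|T\|_A\|\lambda S\|_A$ for all scalars $\lambda$. $T\in B_{A^{1/2}}(\mathbb{H})$ is $(\epsilon,A)$-approximate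 right symmetric in the sense of Chmieliński if for every $S\in B_{A^{1/2}}(\mathbb{H})$ (not necessarily compact), $S\bot_{\epsilon(A)}T$ implies $T\bot_{\epsilon(A)}S$. *)

theory Defs
  imports "HOL-Analysis.Analysis"
begin

(* Meant for linear subspaces V. The library function dim does not distinguish infinite
   dimension from dimension 0. *)
definition infinite_dimensional :: "'a::real_vector set \<Rightarrow> bool" where
  "infinite_dimensional V \<longleftrightarrow> \<not> (\<exists>B. finite B \<and> B \<subseteq> V \<and> V \<subseteq> span B)"

(* The middle conjunct is A = A*, written out as the defining property of the adjoint. *)
definition positive_operator :: "('a::real_inner \<Rightarrow> 'a) \<Rightarrow> bool" where
  "positive_operator A \<longleftrightarrow>
     bounded_linear A \<and> (\<forall>x y. A x \<bullet> y = x \<bullet> A y) \<and> (\<forall>x. A x \<bullet> x \<ge> 0)"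

definition compact_operator :: "('a::real_normed_vector \<Rightarrow> 'b::real_normed_vector) \<Rightarrow> bool" where
  "compact_operator T \<longleftrightarrow> bounded_linear T \<and> (\<forall>S. bounded S \<longrightarrow> compact (closure (T ` S)))"

definition inner_A :: "('a::real_inner \<Rightarrow> 'a) \<Rightarrow> 'a \<Rightarrow> 'a \<Rightarrow> real" where
  "inner_A A x y = A x \<bullet> y"

definition norm_A :: "('a::real_inner \<Rightarrow> 'a) \<Rightarrow> 'a \<Rightarrow> real" where
  "norm_A A x = sqrt (inner_A A x x)"

definition ball_A :: "('a::real_inner \<Rightarrow> 'a) \<Rightarrow> 'a set" where
  "ball_A A = {x. norm_A A x \<le> 1}"

(* The set of A-bounded operators, B_{A^{1/2}}(H). *)
definition A_bounded :: "('a::real_inner \<Rightarrow> 'a) \<Rightarrow> ('a \<Rightarrow> 'a) set" where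
  "A_bounded A =
     {T. bounded_linear T \<and> (\<exists>c>0. \<forall>x. norm_A A (T x) \<le> c * norm_A A x)}"

(* For positive A \<noteq> 0 and A-bounded T the set is nonempty and bounded above, so that Sup is a
   genuine supremum; outside this case the value is unspecified. *)
definition opnorm_A :: "('a::real_inner \<Rightarrow> 'a) \<Rightarrow> ('a \<Rightarrow> 'a) \<Rightarrow> real" where
  "opnorm_A A T = Sup {norm_A A (T x) | x. norm_A A x = 1}"

definition approx_orth ::
  "real \<Rightarrow> ('a::real_inner \<Rightarrow> 'a) \<Rightarrow> ('a \<Rightarrow> 'a) \<Rightarrow> ('a \<Rightarrow> 'a) \<Rightarrow> bool" where
  "approx_orth \<epsilon> A T S \<longleftrightarrow>
     (\<forall>l::real. (opnorm_A A (\<lambda>x. T x + l *\<^sub>R S x))\<^sup>2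
        \<ge> (opnorm_A A T)\<^sup>2 - 2 * \<epsilon> * opnorm_A A T * opnorm_A A (\<lambda>x. l *\<^sub>R S x))"

(* Approximate right symmetry in the sense of Chmielinski, a notion for T in A_bounded A. *)
definition approx_right_symmetric ::
  "real \<Rightarrow> ('a::real_inner \<Rightarrow> 'a) \<Rightarrow> ('a \<Rightarrow> 'a) \<Rightarrow> bool" where
  "approx_right_symmetric \<epsilon> A T \<longleftrightarrow>
     (\<forall>S \<in> A_bounded A. approx_orth \<epsilon> A S T \<longrightarrow> approx_orth \<epsilon> A T S)"

end

(* Modulo the kernel of A, the space is the infinite-dimensional Hilbert space M = closure (range A)
   with the A-inner product, whose norm is equivalent there to the original one. Let c = opnorm_A A T
   be positive. Compactness gives A-orthogonal projections P and Q onto finite-dimensional subspaces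
   of M such that T P and Q T are within d of T. Put S = Q T P + c (I - Q) (I - P). By Pythagoras S
   has norm at most c, and it is c times the identity far out, where T is small; hence S is
   orthogonal to T in the Birkhoff-James sense. On the other hand T - t S has norm at most
   c (1 - t) + 2 d, which for small t and d contradicts approximate orthogonality of T to S,
   because epsilon < 1. *)

theory Submission
  imports Defs
begin

section \<open>Orthogonal projection onto a closed subspace, and closures of subspaces\<close>

text \<open>A sequence in \<open>M\<close> minimizing the distance to \<open>x\<close> is Cauchy by
  the parallelogram law. Its limit attains the minimum, and minimality along each line through the
  limit inside \<open>M\<close> forces orthogonality.\<close>

lemma closed_subspace_projection:
  fixes M :: "'a::{real_inner, complete_space} set"
  assumes "closed M" "subspace M"
  shows "\<exists>m\<in>M. \<forall>y\<in>M. (x - m) \<bullet> y = 0"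
proof -
  define D where "D = (\<lambda>m. (norm (x - m))\<^sup>2) ` M"
  define d where "d = Inf D"
  have ne: "D \<noteq> {}"
    using subspace_0[OF assms(2)] by (auto simp: D_def)
  have bdd: "bdd_below D"
    by (auto simp: D_def intro: bdd_belowI[of _ 0])
  have dle: "d \<le> (norm (x - y))\<^sup>2" if "y \<in> M" for y
    unfolding d_def using bdd that by (auto simp: D_def intro: cInf_lower)
  have "\<exists>m\<in>M. (norm (x - m))\<^sup>2 < d + inverse (real (Suc n))" for n
    using cInf_lessD[OF ne, of "d + inverse (real (Suc n))"] unfolding d_def[symmetric]
    by (auto simp: D_def)
  then obtain m where mM: "\<And>n. m n \<in> M"
    and md: "\<And>n. (norm (x - m n))\<^sup>2 < d + inverse (real (Suc n))"
    by metis
  have dist: "(norm (m i - m j))\<^sup>2 \<le> 2 * inverse (real (Suc i)) + 2 * inverse (real (Suc j))" for i j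
  proof -
    \<comment> \<open>The midpoint stays in \<open>M\<close>, so its squared distance to
      \<open>x\<close> is at least \<open>d\<close>. The parallelogram law turns this into a bound
      on the distance between the two points.\<close>
    have "(1/2) *\<^sub>R (m i + m j) \<in> M"
      using assms(2) mM by (intro subspace_scale subspace_add)
    then have "d \<le> (norm (x - (1/2) *\<^sub>R (m i + m j)))\<^sup>2"
      by (rule dle)
    moreover have "(norm (m i - m j))\<^sup>2 = 2 * (norm (x - m i))\<^sup>2 + 2 * (norm (x - m j))\<^sup>2
        - 4 * (norm (x - (1/2) *\<^sub>R (m i + m j)))\<^sup>2"
      by (simp add: power2_norm_eq_inner algebra_simps inner_commute)
    ultimately show ?thesis
      using md[of i] md[of j] by linarith
  qed
  have "Cauchy m"
  proof (rule metric_CauchyI)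
    fix e :: real assume "0 < e"
    then obtain N where N: "inverse (real (Suc N)) < e\<^sup>2 / 4"
      using reals_Archimedean[of "e\<^sup>2 / 4"] by auto
    have "dist (m i) (m j) < e" if "i \<ge> N" "j \<ge> N" for i j
    proof -
      have "inverse (real (Suc i)) \<le> inverse (real (Suc N))"
        "inverse (real (Suc j)) \<le> inverse (real (Suc N))"
        using that by (simp_all add: le_imp_inverse_le)
      then have "(norm (m i - m j))\<^sup>2 < e\<^sup>2"
        using N dist[of i j] by linarith
      then show ?thesis
        using \<open>0 < e\<close> by (simp add: dist_norm power_less_imp_less_base)
    qed
    then show "\<exists>N. \<forall>i\<ge>N. \<forall>j\<ge>N. dist (m i) (m j) < e" by blast
  qed
  then obtain p where p: "m \<longlonglongrightarrow> p"
    using Cauchy_convergent_iff convergent_def by blast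
  have pM: "p \<in> M"
    using closed_sequentially[OF assms(1)] mM p by blast
  have "(\<lambda>n. (norm (x - m n))\<^sup>2) \<longlonglongrightarrow> (norm (x - p))\<^sup>2"
    by (intro tendsto_intros p)
  moreover have "(\<lambda>n. d + inverse (real (Suc n))) \<longlonglongrightarrow> d + 0"
    by (intro tendsto_add tendsto_const LIMSEQ_inverse_real_of_nat)
  ultimately have pd: "(norm (x - p))\<^sup>2 \<le> d"
    using LIMSEQ_le[of "\<lambda>n. (norm (x - m n))\<^sup>2"] md by (fastforce intro: less_imp_le)
  have "(x - p) \<bullet> y = 0" if "y \<in> M" for y
  proof (cases "y = 0")
    case False
    \<comment> \<open>The minimizer of the squared norm of \<open>(x - p) - s *\<^sub>R y\<close>
      over all real \<open>s\<close>.\<close>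
    define s where "s = ((x - p) \<bullet> y) / (y \<bullet> y)"
    have yy: "y \<bullet> y > 0" using False by simp
    have "p + s *\<^sub>R y \<in> M"
      using assms(2) pM that by (intro subspace_scale subspace_add)
    from dle[OF this] pd have "(norm (x - p))\<^sup>2 \<le> (norm ((x - p) - s *\<^sub>R y))\<^sup>2"
      by (simp only: diff_diff_add)
    also have "\<dots> = (norm (x - p))\<^sup>2 - 2 * s * ((x - p) \<bullet> y) + s * (s * (y \<bullet> y))"
      unfolding power2_norm_eq_inner by (simp add: inner_diff_left inner_diff_right inner_commute)
    also have "s * (y \<bullet> y) = (x - p) \<bullet> y"
      using yy by (simp add: s_def)
    finally have "s * ((x - p) \<bullet> y) \<le> 0" by simp
    then have "((x - p) \<bullet> y)\<^sup>2 \<le> 0"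
      using yy by (simp add: s_def power2_eq_square divide_le_0_iff)
    then show ?thesis by simp
  qed simp
  then show ?thesis using pM by blast
qed

lemma subspace_closure:
  fixes S :: "'a::real_normed_vector set"
  assumes "subspace S" shows "subspace (closure S)"
proof (rule subspaceI)
  show "0 \<in> closure S"
    using subspace_0[OF assms] closure_subset by blast
  show "x + y \<in> closure S" if xy: "x \<in> closure S" "y \<in> closure S" for x y
  proof -
    obtain f g where "\<And>n. f n \<in> S" "f \<longlonglongrightarrow> x" "\<And>n. g n \<in> S" "g \<longlonglongrightarrow> y"
      using xy unfolding closure_sequential by blast
    then show ?thesis
      unfolding closure_sequential
      by (intro exI[of _ "\<lambda>n. f n + g n"]) (simp add: subspace_add[OF assms] tendsto_add)
  qed
  show "c *\<^sub>R x \<in> closure S" if x: "x \<in> closure S" for c x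
  proof -
    obtain f where "\<And>n. f n \<in> S" "f \<longlonglongrightarrow> x"
      using x unfolding closure_sequential by blast
    then show ?thesis
      unfolding closure_sequential
      by (intro exI[of _ "\<lambda>n. c *\<^sub>R f n"]) (simp add: subspace_scale[OF assms] tendsto_scaleR)
  qed
qed

section \<open>The semi-inner product and seminorm of a positive operator\<close>

locale positive_op =
  fixes A :: "'a::real_inner \<Rightarrow> 'a"
  assumes positive: "positive_operator A"
begin

abbreviation ip where "ip \<equiv> inner_A A"
abbreviation nA where "nA \<equiv> norm_A A"

lemma bounded_linear_A: "bounded_linear A"
  using positive by (simp add: positive_operator_def)

lemma linear_A: "linear A"
  using bounded_linear_A by (rule bounded_linear.linear)

lemma ip_commute: "ip x y = ip y x"
  using positive by (simp add: positive_operator_def inner_A_def inner_commute)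

lemma ip_ge_0: "0 \<le> ip x x"
  using positive unfolding positive_operator_def inner_A_def by blast

lemma ip_add_left: "ip (x + y) z = ip x z + ip y z"
  by (simp add: inner_A_def linear_add[OF linear_A] inner_add_left)

lemma ip_diff_left: "ip (x - y) z = ip x z - ip y z"
  by (simp add: inner_A_def linear_diff[OF linear_A] inner_diff_left)

lemma ip_scale_left: "ip (r *\<^sub>R x) z = r * ip x z"
  by (simp add: inner_A_def linear_scale[OF linear_A])

lemma ip_zero_left: "ip 0 z = 0"
  by (simp add: inner_A_def linear_0[OF linear_A])

lemma ip_add_right: "ip z (x + y) = ip z x + ip z y"
  and ip_diff_right: "ip z (x - y) = ip z x - ip z y"
  and ip_scale_right: "ip z (r *\<^sub>R x) = r * ip z x"
  and ip_zero_right: "ip z 0 = 0"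
  by (simp_all add: inner_A_def inner_add_right inner_diff_right)

lemmas ip_simps = ip_add_left ip_diff_left ip_scale_left ip_zero_left
  ip_add_right ip_diff_right ip_scale_right ip_zero_right

lemma ip_sum_left: "ip (\<Sum>i\<in>I. f i) z = (\<Sum>i\<in>I. ip (f i) z)"
  by (induction I rule: infinite_finite_induct) (simp_all add: ip_simps)

lemma ip_sum_right: "ip z (\<Sum>i\<in>I. f i) = (\<Sum>i\<in>I. ip z (f i))"
  by (simp add: inner_A_def inner_sum_right)

lemma nA_sq: "(nA x)\<^sup>2 = ip x x"
  by (simp add: norm_A_def ip_ge_0)

lemma nA_ge_0: "0 \<le> nA x"
  by (simp add: norm_A_def ip_ge_0)

lemma nA_scale: "nA (r *\<^sub>R x) = \<bar>r\<bar> * nA x"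
  by (simp add: norm_A_def ip_simps real_sqrt_mult flip: mult.assoc power2_eq_square)

lemma nA_minus: "nA (x - y) = nA (y - x)"
  using nA_scale[of "-1" "x - y"] by simp

lemma nA_zero: "nA 0 = 0"
  by (simp add: norm_A_def ip_simps)

text \<open>Since \<open>ip\<close> may be degenerate, the case \<open>ip y y = 0\<close> needs its
  own argument: there the quadratic in \<open>s\<close> is affine, and an affine function bounded
  below has slope 0.\<close>

lemma cauchy_schwarz: "ip x y \<le> nA x * nA y"
proof -
  have *: "(ip x y)\<^sup>2 \<le> ip x x * ip y y"
  proof (cases "ip y y = 0")
    case True
    have quad: "0 \<le> ip x x - 2 * s * ip x y + s\<^sup>2 * ip y y" for s
      using ip_ge_0[of "x - s *\<^sub>R y"]
      by (simp add: ip_simps ip_commute[of y x] power2_eq_square algebra_simps)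
    have "ip x y = 0"
    proof (rule ccontr)
      assume "ip x y \<noteq> 0"
      then show False
        \<comment> \<open>At this \<open>s\<close> the affine expression takes the value -1.\<close>
        using quad[of "(ip x x + 1) / (2 * ip x y)"] True by simp
    qed
    then show ?thesis using True by simp
  next
    case False
    then have yy: "ip y y > 0" using ip_ge_0[of y] by simp
    have "0 \<le> ip (ip y y *\<^sub>R x - ip x y *\<^sub>R y) (ip y y *\<^sub>R x - ip x y *\<^sub>R y)"
      by (rule ip_ge_0)
    also have "\<dots> = ip y y * (ip x x * ip y y - (ip x y)\<^sup>2)"
      by (simp add: ip_simps ip_commute[of y x] power2_eq_square algebra_simps)
    finally show ?thesis using yy by (simp add: zero_le_mult_iff)
  qed
  have "ip x y \<le> sqrt ((ip x y)\<^sup>2)" by simp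
  also have "\<dots> \<le> sqrt (ip x x * ip y y)" using * by (rule real_sqrt_le_mono)
  finally show ?thesis by (simp add: norm_A_def real_sqrt_mult)
qed

lemma nA_triangle: "nA (x + y) \<le> nA x + nA y"
proof (rule power2_le_imp_le)
  have "(nA (x + y))\<^sup>2 = (nA x)\<^sup>2 + (nA y)\<^sup>2 + 2 * ip x y"
    by (simp add: nA_sq ip_simps ip_commute[of y x])
  also have "\<dots> \<le> (nA x + nA y)\<^sup>2"
    using cauchy_schwarz[of x y] by (simp add: power2_sum)
  finally show "(nA (x + y))\<^sup>2 \<le> (nA x + nA y)\<^sup>2" .
qed (simp add: nA_ge_0)

lemma nA_diff_le: "nA (x - y) \<le> nA x + nA y"
  using nA_triangle[of x "- y"] nA_scale[of "-1" y] by simp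

lemma nA_triangle_sub: "nA x \<le> nA y + nA (x - y)"
  using nA_triangle[of y "x - y"] by simp

lemma nA_sum_le: "nA (\<Sum>i\<in>I. f i) \<le> (\<Sum>i\<in>I. nA (f i))"
proof (induction I rule: infinite_finite_induct)
  case (insert i I)
  then show ?case using nA_triangle[of "f i" "\<Sum>i\<in>I. f i"] by simp
qed (simp_all add: nA_zero)

text \<open>This allows a vector to be replaced by any representative modulo the A-null
  vectors.\<close>

lemma nA_cong:
  assumes "nA (x - y) = 0" shows "nA x = nA y"
  using assms nA_triangle_sub[of x y] nA_triangle_sub[of y x] nA_minus[of x y] by simp

lemma ip_eq_0:
  assumes "nA x = 0" shows "ip x y = 0"
  using assms cauchy_schwarz[of x y] cauchy_schwarz[of "- x" y] nA_scale[of "-1" x]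
    ip_scale_left[of "-1" x y] by simp

text \<open>Transfers convergence and finite nets from the Hilbert norm to the A-norm.\<close>

lemma nA_le_norm:
  obtains K where "0 < K" "\<And>x. nA x \<le> K * norm x"
proof -
  obtain C where C: "0 < C" "\<And>x. norm (A x) \<le> norm x * C"
    using bounded_linear.pos_bounded[OF bounded_linear_A] by blast
  have "nA x \<le> sqrt C * norm x" for x
  proof -
    have "ip x x \<le> norm (A x) * norm x"
      unfolding inner_A_def by (rule norm_cauchy_schwarz)
    also have "\<dots> \<le> (norm x * C) * norm x"
      by (intro mult_right_mono C) simp
    finally have "nA x \<le> sqrt (C * (norm x)\<^sup>2)"
      by (simp add: norm_A_def power2_eq_square algebra_simps)
    then show ?thesis by (simp add: real_sqrt_mult)
  qed
  then show thesis using that[of "sqrt C"] C by simp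
qed

section \<open>Finite A-orthonormal sets, their projections, and Gram-Schmidt\<close>

text \<open>Finiteness is built in because \<open>proj\<close> sums over \<open>B\<close>, and a sum
  over an infinite set is 0 by convention.\<close>

definition orthonormal :: "'a set \<Rightarrow> bool" where
  "orthonormal B \<longleftrightarrow> finite B \<and> (\<forall>b\<in>B. \<forall>b'\<in>B. ip b b' = (if b = b' then 1 else 0))"

definition proj :: "'a set \<Rightarrow> 'a \<Rightarrow> 'a" where
  "proj B x = (\<Sum>b\<in>B. ip x b *\<^sub>R b)"

lemma bounded_linear_proj: "bounded_linear (proj B)"
  unfolding proj_def inner_A_def
  by (rule bounded_linear_sum)
    (rule bounded_linear_compose[OF bounded_linear_scaleR_left
        bounded_linear_compose[OF bounded_linear_inner_left bounded_linear_A]])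

lemma linear_proj: "linear (proj B)"
  using bounded_linear_proj by (rule bounded_linear.linear)

lemma ip_proj_basis:
  assumes "orthonormal B" "b \<in> B"
  shows "ip (proj B x) b = ip x b"
proof -
  have "ip (proj B x) b = (\<Sum>b'\<in>B. ip x b' * (if b' = b then 1 else 0))"
    unfolding proj_def ip_sum_left
    using assms by (intro sum.cong) (auto simp: ip_simps orthonormal_def)
  also have "\<dots> = (\<Sum>b'\<in>B. if b' = b then ip x b' else 0)"
    by (intro sum.cong) auto
  also have "\<dots> = ip x b"
    using assms by (simp add: orthonormal_def)
  finally show ?thesis .
qed

lemma ip_residual_basis:
  assumes "orthonormal B" "b \<in> B"
  shows "ip (x - proj B x) b = 0"
  using ip_proj_basis[OF assms] by (simp add: ip_simps)

lemma ip_residual_proj: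
  assumes "orthonormal B"
  shows "ip (x - proj B x) (proj B y) = 0"
  unfolding proj_def[of B y] ip_sum_right ip_scale_right
  by (rule sum.neutral) (simp add: ip_residual_basis[OF assms])

lemma pythagoras:
  assumes "ip x y = 0"
  shows "(nA (x + y))\<^sup>2 = (nA x)\<^sup>2 + (nA y)\<^sup>2"
  using assms by (simp add: nA_sq ip_simps ip_commute[of y x])

lemma pythagoras_diff:
  assumes "ip y (x - y) = 0"
  shows "(nA x)\<^sup>2 = (nA y)\<^sup>2 + (nA (x - y))\<^sup>2"
  using pythagoras[OF assms] by simp

lemma nA_proj_sq:
  assumes "orthonormal B"
  shows "(nA x)\<^sup>2 = (nA (proj B x))\<^sup>2 + (nA (x - proj B x))\<^sup>2"
  by (rule pythagoras_diff, subst ip_commute, rule ip_residual_proj[OF assms])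

lemma nA_proj_le:
  assumes "orthonormal B" shows "nA (proj B x) \<le> nA x"
  by (rule power2_le_imp_le) (simp_all add: nA_proj_sq[OF assms, of x] nA_ge_0)

lemma nA_residual_le:
  assumes "orthonormal B" shows "nA (x - proj B x) \<le> nA x"
  by (rule power2_le_imp_le) (simp_all add: nA_proj_sq[OF assms, of x] nA_ge_0)

lemma proj_eq_0:
  assumes "\<And>b. b \<in> B \<Longrightarrow> ip x b = 0" shows "proj B x = 0"
  using assms by (simp add: proj_def)

lemma proj_in_span: "proj B x \<in> span B"
  unfolding proj_def by (intro span_sum span_scale span_base)

lemma proj_fix:
  assumes "orthonormal B" "b \<in> B" shows "proj B b = b"
proof -
  have "proj B b = (\<Sum>b'\<in>B. if b' = b then b' else 0)"
    unfolding proj_def using assms by (intro sum.cong) (auto simp: orthonormal_def)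
  then show ?thesis using assms by (simp add: orthonormal_def)
qed

text \<open>Definiteness of the seminorm on \<open>M\<close> is what permits normalizing: a nonzero
  residual, which stays in \<open>M\<close>, has positive A-norm.\<close>

lemma gram_schmidt:
  assumes "finite Y" "Y \<subseteq> M" "subspace M" "\<And>x. x \<in> M \<Longrightarrow> nA x = 0 \<Longrightarrow> x = 0"
  shows "\<exists>B. orthonormal B \<and> B \<subseteq> M \<and> Y \<subseteq> span B"
  using assms(1,2)
proof (induction Y)
  case empty
  show ?case by (intro exI[of _ "{}"]) (simp add: orthonormal_def)
next
  case (insert y Y)
  then obtain B where B: "orthonormal B" "B \<subseteq> M" "Y \<subseteq> span B" by auto
  define r where "r = y - proj B y"
  have sub: "span B \<subseteq> M"
    using B(2) assms(3) by (rule span_minimal)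
  have rM: "r \<in> M"
    using insert.prems sub proj_in_span[of B y] by (auto simp: r_def intro: subspace_diff[OF assms(3)])
  show ?case
  proof (cases "r = 0")
    case True
    then have "y \<in> span B" using proj_in_span[of B y] by (simp add: r_def)
    then show ?thesis using B by auto
  next
    case False
    then have pos: "0 < nA r" using assms(4)[OF rM] nA_ge_0[of r] by fastforce
    define b where "b = (1 / nA r) *\<^sub>R r"
    have "nA b = 1" using pos by (simp add: b_def nA_scale)
    then have bb: "ip b b = 1" using nA_sq[of b] by simp
    have bB: "ip b b' = 0" "ip b' b = 0" if "b' \<in> B" for b'
      using ip_residual_basis[OF B(1) that, of y] ip_commute[of b' b]
      by (simp_all add: b_def ip_simps r_def)
    have "orthonormal (insert b B)"
      using B(1) bb bB by (auto simp: orthonormal_def)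
    moreover have "insert b B \<subseteq> M"
      using B(2) rM by (auto simp: b_def intro: subspace_scale[OF assms(3)])
    moreover have "y \<in> span (insert b B)"
    proof -
      have "y = nA r *\<^sub>R b + proj B y"
        using pos by (simp add: b_def r_def)
      moreover have "proj B y \<in> span (insert b B)"
        using proj_in_span[of B y] span_mono[of B "insert b B"] by auto
      ultimately show ?thesis
        by (metis insertI1 span_add span_base span_scale)
    qed
    moreover have "Y \<subseteq> span (insert b B)"
      using B(3) span_mono[of B "insert b B"] by auto
    ultimately show ?thesis by blast
  qed
qed

lemma ip_span_eq_0:
  assumes "\<And>b. b \<in> B \<Longrightarrow> ip x b = 0" "y \<in> span B"
  shows "ip x y = 0"
  using assms(2,1) by (induction rule: span_induct_alt) (simp_all add: ip_simps)

lemma proj_fix_span: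
  assumes "orthonormal B" "y \<in> span B" shows "proj B y = y"
  using assms(2)
proof (induction rule: span_induct_alt)
  case base
  show ?case using linear_0[OF linear_proj] .
next
  case (step c b y)
  then show ?case
    using proj_fix[OF assms(1)] by (simp add: linear_add[OF linear_proj] linear_scale[OF linear_proj])
qed

text \<open>Best approximation: \<open>proj B\<close> fixes \<open>y\<close>, so \<open>z\<close>
  and \<open>z - y\<close> have the same residual, and taking residuals does not increase the
  A-norm.\<close>

lemma nA_residual_le_diff:
  assumes "orthonormal B" "y \<in> span B"
  shows "nA (z - proj B z) \<le> nA (z - y)"
proof -
  have "z - proj B z = (z - y) - proj B (z - y)"
    using proj_fix_span[OF assms] by (simp add: linear_diff[OF linear_proj])
  then show ?thesis using nA_residual_le[OF assms(1)] by metis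
qed

section \<open>A-bounded operators and their operator seminorm\<close>

lemma A_boundedE:
  assumes "T \<in> A_bounded A"
  obtains c where "0 < c" "\<And>x. nA (T x) \<le> c * nA x" "bounded_linear T"
  using assms by (auto simp: A_bounded_def)

lemma A_boundedI:
  assumes "bounded_linear T" "\<And>x. nA (T x) \<le> c * nA x"
  shows "T \<in> A_bounded A"
proof -
  \<comment> \<open>The definition demands a positive constant, while \<open>c\<close> is an
    arbitrary real here.\<close>
  have "nA (T x) \<le> max c 1 * nA x" for x
    using assms(2)[of x] mult_right_mono[OF max.cobounded1[of c 1] nA_ge_0[of x]] by linarith
  moreover have "0 < max c 1" by simp
  ultimately show ?thesis using assms(1) by (auto simp: A_bounded_def)
qed

text \<open>The A-unit vector \<open>u\<close> makes the set under the supremum nonempty.\<close>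

lemma opnorm_le:
  assumes "nA u = 1" "\<And>x. nA (T x) \<le> c * nA x"
  shows "opnorm_A A T \<le> c"
  unfolding opnorm_A_def
proof (rule cSup_least)
  show "{nA (T x) |x. nA x = 1} \<noteq> {}" using assms(1) by blast
  fix y assume "y \<in> {nA (T x) |x. nA x = 1}"
  then obtain x where "y = nA (T x)" "nA x = 1" by blast
  then show "y \<le> c" using assms(2)[of x] by simp
qed

lemma opnorm_ge_unit:
  assumes "\<And>x. nA (T x) \<le> c * nA x" "nA x = 1"
  shows "nA (T x) \<le> opnorm_A A T"
  unfolding opnorm_A_def
proof (rule cSup_upper)
  show "bdd_above {nA (T x) |x. nA x = 1}"
    using assms(1) by (intro bdd_aboveI[of _ c]) (auto, metis mult.right_neutral)
qed (use assms in auto)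

lemma opnorm_bound:
  assumes "linear T" "\<And>x. nA (T x) \<le> c * nA x"
  shows "nA (T x) \<le> opnorm_A A T * nA x"
proof (cases "nA x = 0")
  \<comment> \<open>An A-null vector cannot be normalized, but A-boundedness makes its image A-null
    too.\<close>
  case True
  then show ?thesis using assms(2)[of x] by simp
next
  case False
  then have pos: "0 < nA x" using nA_ge_0[of x] by simp
  have "nA (T ((1 / nA x) *\<^sub>R x)) \<le> opnorm_A A T"
    using pos by (intro opnorm_ge_unit[OF assms(2)]) (simp add: nA_scale)
  then show ?thesis
    using pos by (simp add: linear_scale[OF assms(1)] nA_scale field_simps)
qed

end

section \<open>Geometry of the closed range of A, on which the two norms are equivalent\<close>

locale positive_op_coercive = positive_op A for A :: "'a::{real_inner, complete_space} \<Rightarrow> 'a" +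
  assumes bounded_ball: "bounded (ball_A A \<inter> closure (range A))"
    and infinite_dim: "infinite_dimensional (closure (range A))"
begin

abbreviation M where "M \<equiv> closure (range A)"

lemma subspace_M: "subspace M"
  using linear_subspace_image[OF linear_A subspace_UNIV] by (rule subspace_closure)

text \<open>Project \<open>x\<close> onto \<open>M\<close> in the Hilbert inner product. The
  residual is orthogonal to its own image under \<open>A\<close>, which lies in \<open>M\<close>, so
  it is A-null.\<close>

lemma split_kernel:
  obtains m where "m \<in> M" "nA (x - m) = 0"
proof -
  obtain m where m: "m \<in> M" "\<And>y. y \<in> M \<Longrightarrow> (x - m) \<bullet> y = 0"
    using closed_subspace_projection[OF closed_closure subspace_M, of x] by blast
  have "A (x - m) \<in> M" by (intro subsetD[OF closure_subset] rangeI)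
  then have "(x - m) \<bullet> A (x - m) = 0" by (rule m(2))
  then have "ip (x - m) (x - m) = 0" by (simp add: inner_A_def inner_commute)
  then show thesis using that m(1) by (simp add: norm_A_def)
qed

text \<open>Boundedness of the A-unit ball in \<open>M\<close> becomes a norm inequality by scaling
  to A-norm 1.\<close>

lemma coercive:
  obtains R where "0 < R" "\<And>x. x \<in> M \<Longrightarrow> norm x \<le> R * nA x"
proof -
  obtain R where R: "0 < R" "\<And>x. x \<in> ball_A A \<inter> M \<Longrightarrow> norm x \<le> R"
    using bounded_ball[unfolded bounded_pos] by metis
  have "norm x \<le> R * nA x" if x: "x \<in> M" for x
  proof (cases "nA x = 0")
    case True
    \<comment> \<open>Every multiple of an A-null vector lies in the A-ball. The multiple chosen
      next would have norm \<open>R + 1\<close> if \<open>x\<close> were nonzero.\<close>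
    have "norm (r *\<^sub>R x) \<le> R" for r
      using True x by (intro R) (simp add: ball_A_def nA_scale subspace_scale[OF subspace_M])
    from this[of "(R + 1) / norm x"] have "x = 0"
      using R(1) by (cases "x = 0") auto
    then show ?thesis using R(1) nA_ge_0 by simp
  next
    case False
    then have pos: "0 < nA x" using nA_ge_0[of x] by simp
    have "norm ((1 / nA x) *\<^sub>R x) \<le> R"
      using pos x by (intro R) (simp add: ball_A_def nA_scale subspace_scale[OF subspace_M])
    then show ?thesis using pos by (simp add: field_simps)
  qed
  then show thesis using that R(1) by blast
qed

lemma definite_M:
  assumes "x \<in> M" "nA x = 0" shows "x = 0"
proof -
  obtain R where "norm x \<le> R * nA x" using coercive assms(1) by metis
  then show ?thesis using assms(2) by simp
qed

lemma gram_schmidt_M: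
  assumes "finite Y" "Y \<subseteq> M"
  obtains B where "orthonormal B" "B \<subseteq> M" "Y \<subseteq> span B"
  using gram_schmidt[OF assms subspace_M definite_M] by blast

text \<open>Infinite dimension gives a vector of \<open>M\<close> outside the span of a finite
  orthonormal set whose span contains \<open>Y\<close>. Its residual is nonzero and can be
  normalized.\<close>

lemma orthogonal_unit:
  assumes "finite Y" "Y \<subseteq> M"
  obtains x where "x \<in> M" "nA x = 1" "\<And>y. y \<in> Y \<Longrightarrow> ip x y = 0"
proof -
  obtain B where B: "orthonormal B" "B \<subseteq> M" "Y \<subseteq> span B"
    using gram_schmidt_M[OF assms] .
  have sub: "span B \<subseteq> M" using B(2) subspace_M by (rule span_minimal)
  have "finite B" using B(1) by (simp add: orthonormal_def)
  then obtain z where z: "z \<in> M" "z \<notin> span B"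
    using infinite_dim B(2) by (auto simp: infinite_dimensional_def)
  define r where "r = z - proj B z"
  have rM: "r \<in> M"
    using z(1) sub proj_in_span[of B z] by (auto simp: r_def intro: subspace_diff[OF subspace_M])
  have "r \<noteq> 0" using z(2) proj_in_span[of B z] by (auto simp: r_def)
  then have pos: "0 < nA r" using definite_M[OF rM] nA_ge_0[of r] by fastforce
  show thesis
  proof
    show "(1 / nA r) *\<^sub>R r \<in> M" by (rule subspace_scale[OF subspace_M rM])
    show "nA ((1 / nA r) *\<^sub>R r) = 1" using pos by (simp add: nA_scale)
    fix y assume "y \<in> Y"
    then have "ip r y = 0"
      using ip_span_eq_0[of B r y] ip_residual_basis[OF B(1), of _ z] B(3) by (auto simp: r_def)
    then show "ip ((1 / nA r) *\<^sub>R r) y = 0" by (simp add: ip_simps)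
  qed
qed

section \<open>Compact operators: smallness far out and finite-rank approximation\<close>

text \<open>Otherwise there is an A-orthonormal sequence on which T is bounded away from 0 and converges;
  the sum of n of its members has A-norm sqrt n, but the A-norm of its image grows linearly.\<close>

lemma compact_small_on_orthogonal:
  assumes T: "T \<in> A_bounded A" and K: "compact_operator T" and \<delta>: "0 < \<delta>"
  obtains Y where "finite Y" "Y \<subseteq> M"
    "\<And>x. (\<And>y. y \<in> Y \<Longrightarrow> ip x y = 0) \<Longrightarrow> nA (T x) \<le> \<delta> * nA x"
proof (rule ccontr)
  assume neg: "\<not> thesis"
  note small = that
  obtain c where c: "0 < c" "\<And>x. nA (T x) \<le> c * nA x" and bl: "bounded_linear T"
    using A_boundedE[OF T] by blast
  have lT: "linear T" using bl by (rule bounded_linear.linear)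
  have ex: "\<exists>x. x \<in> M \<and> nA x = 1 \<and> (\<forall>y\<in>Y. ip x y = 0) \<and> \<delta> < nA (T x)"
    if Y: "finite Y" "Y \<subseteq> M" for Y
  proof -
    obtain x where x: "\<And>y. y \<in> Y \<Longrightarrow> ip x y = 0" "\<delta> * nA x < nA (T x)"
      using neg small[OF Y] not_le by metis
    \<comment> \<open>The failing vector \<open>x\<close> need not lie in \<open>M\<close>. Its
      representative \<open>m\<close> has the same A-norm, the same A-inner products, and an image
      of the same A-norm, so it fails as well.\<close>
    obtain m where m: "m \<in> M" "nA (x - m) = 0" using split_kernel .
    have "nA (T x - T m) = 0"
      using c(2)[of "x - m"] m(2) nA_ge_0[of "T (x - m)"] by (simp add: linear_diff[OF lT])
    then have Tm: "nA (T x) = nA (T m)" by (rule nA_cong)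
    have xm: "nA x = nA m" using m(2) by (rule nA_cong)
    have my: "ip m y = 0" if "y \<in> Y" for y
      using ip_eq_0[OF m(2), of y] x(1)[OF that] by (simp add: ip_simps)
    have "nA m \<noteq> 0" using x(2) c(2)[of m] Tm xm by auto
    then have pos: "0 < nA m" using nA_ge_0[of m] by simp
    have "\<delta> < nA (T ((1 / nA m) *\<^sub>R m))"
      using x(2) Tm xm pos by (simp add: linear_scale[OF lT] nA_scale field_simps)
    then show ?thesis
      using pos m(1) my
      by (intro exI[of _ "(1 / nA m) *\<^sub>R m"]) (simp add: nA_scale ip_simps subspace_scale[OF subspace_M])
  qed
  then obtain f where f: "\<And>Y. finite Y \<Longrightarrow> Y \<subseteq> M \<Longrightarrow>
      f Y \<in> M \<and> nA (f Y) = 1 \<and> (\<forall>y\<in>Y. ip (f Y) y = 0) \<and> \<delta> < nA (T (f Y))"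
    by metis
  \<comment> \<open>\<open>E n\<close> collects the vectors chosen in the first \<open>n\<close>
    steps; the next one is taken A-orthogonal to all of them.\<close>
  define E where "E = rec_nat {} (\<lambda>_ B. insert (f B) B)"
  have E0: "E 0 = {}" and ES: "\<And>n. E (Suc n) = insert (f (E n)) (E n)"
    by (simp_all add: E_def)
  have E: "finite (E n) \<and> E n \<subseteq> M" for n
    by (induction n) (use f E0 ES in auto)
  define e where "e n = f (E n)" for n
  have eM: "e n \<in> M" "nA (e n) = 1" "\<delta> < nA (T (e n))" and eE: "\<And>y. y \<in> E n \<Longrightarrow> ip (e n) y = 0" for n
    using f E by (auto simp: e_def)
  have mono: "E i \<subseteq> E j" if "i \<le> j" for i j
    using that by (rule lift_Suc_mono_le[rotated]) (use ES in auto)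
  have orth: "ip (e i) (e j) = 0" if "i \<noteq> j" for i j
  proof -
    have *: "ip (e j) (e i) = 0" if "i < j" for i j
    proof (rule eE)
      have "e i \<in> E (Suc i)" by (simp add: ES e_def)
      then show "e i \<in> E j" using mono[of "Suc i" j] that by auto
    qed
    then show ?thesis using that ip_commute by (metis linorder_neqE_nat)
  qed
  obtain R where R: "0 < R" "\<And>x. x \<in> M \<Longrightarrow> norm x \<le> R * nA x" using coercive by blast
  \<comment> \<open>Coercivity turns A-norm 1 into a Hilbert norm bound, so compactness of
    \<open>T\<close> applies and a subsequence of images converges.\<close>
  have "bounded (range e)"
    using R(2)[OF eM(1)] eM(2) by (intro boundedI[of _ R]) auto
  then have "compact (closure (T ` range e))"
    using K by (simp add: compact_operator_def)
  moreover have "\<forall>n. (T \<circ> e) n \<in> closure (T ` range e)"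
    by (auto intro!: subsetD[OF closure_subset])
  ultimately obtain l r where r: "strict_mono r" and l: "((T \<circ> e) \<circ> r) \<longlonglongrightarrow> l"
    unfolding compact_def by meson
  define u where "u = e \<circ> r"
  have rinj: "r i = r j \<longleftrightarrow> i = j" for i j
    using strict_mono_eq[OF r] .
  have u: "ip (u i) (u j) = (if i = j then 1 else 0)" for i j
    using orth[of "r i" "r j"] rinj[of i j] eM(2)[of "r i"] nA_sq[of "e (r i)"] by (auto simp: u_def)
  obtain k where k: "0 < k" "\<And>x. nA x \<le> k * norm x" using nA_le_norm by blast
  \<comment> \<open>The factor \<open>k\<close> from \<open>nA_le_norm\<close> converts this
    tolerance into A-distance at most \<open>\<delta> / 4\<close>.\<close>
  obtain N where N: "\<And>n. n \<ge> N \<Longrightarrow> norm (T (u n) - l) < \<delta> / (4 * k)"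
    using LIMSEQ_D[OF l, of "\<delta> / (4 * k)"] \<delta> k(1) by (auto simp: u_def)
  have close: "nA (T (u n) - l) \<le> \<delta> / 4" if "n \<ge> N" for n
  proof -
    have "k * norm (T (u n) - l) \<le> k * (\<delta> / (4 * k))"
      using N[OF that] k(1) by (intro mult_left_mono) auto
    then show ?thesis using k(1) k(2)[of "T (u n) - l"] by simp
  qed
  have lbig: "3 * \<delta> / 4 \<le> nA l"
    using close[of N] eM(3)[of "r N"] nA_triangle_sub[of "T (u N)" l] by (simp add: u_def)
  have lin: "real n * (\<delta> / 2) \<le> c * sqrt (real n)" for n
  proof -
    \<comment> \<open>By orthonormality \<open>v\<close> has A-norm \<open>sqrt (real n)\<close>.
      Its image is within \<open>n * \<delta> / 4\<close> of \<open>n\<close> times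
      \<open>l\<close>, whose A-norm is at least \<open>3 * n * \<delta> / 4\<close>, which leaves
      \<open>n * \<delta> / 2\<close>.\<close>
    define v where "v = (\<Sum>i<n. u (N + i))"
    have "ip v v = (\<Sum>i<n. \<Sum>j<n. ip (u (N + i)) (u (N + j)))"
      by (simp only: v_def ip_sum_left, simp only: ip_sum_right)
    also have "\<dots> = real n" by (simp add: u)
    finally have nv: "nA v = sqrt (real n)" by (simp add: norm_A_def)
    have Tv: "T v - real n *\<^sub>R l = (\<Sum>i<n. T (u (N + i)) - l)"
      by (simp add: v_def linear_sum[OF lT] sum_subtractf sum_constant_scaleR)
    have "nA (T v - real n *\<^sub>R l) \<le> (\<Sum>i<n. nA (T (u (N + i)) - l))"
      unfolding Tv by (rule nA_sum_le)
    also have "\<dots> \<le> (\<Sum>i<n. \<delta> / 4)" by (intro sum_mono close) simp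
    finally have "nA (T v - real n *\<^sub>R l) \<le> real n * (\<delta> / 4)" by simp
    moreover have "real n * nA l \<le> nA (T v) + nA (T v - real n *\<^sub>R l)"
      using nA_triangle_sub[of "real n *\<^sub>R l" "T v"] nA_minus[of "real n *\<^sub>R l" "T v"]
      by (simp add: nA_scale)
    moreover have "real n * (3 * \<delta> / 4) \<le> real n * nA l"
      using lbig by (intro mult_left_mono) auto
    ultimately have "real n * (\<delta> / 2) \<le> nA (T v)" by simp
    also have "\<dots> \<le> c * sqrt (real n)" using c(2)[of v] nv by simp
    finally show ?thesis .
  qed
  obtain q :: nat where q: "2 * c / \<delta> < real q" using reals_Archimedean2 by blast
  have "0 < 2 * c / \<delta>" using c(1) \<delta> by simp
  then have q0: "0 < real q" using q by linarith
  \<comment> \<open>Taking \<open>n = q * q\<close> makes the square root equal to \<open>q\<close>,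
    which then cancels.\<close>
  have "real q * (real q * (\<delta> / 2)) \<le> real q * c"
    using lin[of "q * q"] by (simp add: real_sqrt_mult algebra_simps)
  then have "real q * (\<delta> / 2) \<le> c" using q0 by (simp only: mult_le_cancel_left_pos)
  then show False using q \<delta> by (simp add: field_simps)
qed

text \<open>With \<open>B\<close> chosen so that its span contains the finite set \<open>Y\<close>
  of \<open>compact_small_on_orthogonal\<close>, every residual of \<open>proj B\<close> is
  A-orthogonal to \<open>Y\<close>.\<close>

lemma compact_approx_right:
  assumes T: "T \<in> A_bounded A" and K: "compact_operator T" and \<delta>: "0 < \<delta>"
  obtains B where "orthonormal B" "B \<subseteq> M" "\<And>x. nA (T (x - proj B x)) \<le> \<delta> * nA x"
proof -
  obtain Y where Y: "finite Y" "Y \<subseteq> M"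
    "\<And>x. (\<And>y. y \<in> Y \<Longrightarrow> ip x y = 0) \<Longrightarrow> nA (T x) \<le> \<delta> * nA x"
    using compact_small_on_orthogonal[OF assms] by blast
  obtain B where B: "orthonormal B" "B \<subseteq> M" "Y \<subseteq> span B"
    using gram_schmidt_M[OF Y(1,2)] .
  have "nA (T (x - proj B x)) \<le> \<delta> * nA x" for x
  proof -
    have "nA (T (x - proj B x)) \<le> \<delta> * nA (x - proj B x)"
    proof (rule Y(3))
      fix y assume "y \<in> Y"
      with B(3) have "y \<in> span B" by blast
      then show "ip (x - proj B x) y = 0"
        by (rule ip_span_eq_0[rotated]) (rule ip_residual_basis[OF B(1)])
    qed
    also have "\<dots> \<le> \<delta> * nA x"
      using \<delta> nA_residual_le[OF B(1)] by (intro mult_left_mono) auto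
    finally show ?thesis .
  qed
  then show thesis using that B by blast
qed

text \<open>The image of the A-unit ball of \<open>M\<close> is totally bounded. A finite net for
  it, orthonormalized, spans a subspace close to every image point, and projection is the best
  approximation.\<close>

lemma compact_approx_left:
  assumes T: "T \<in> A_bounded A" and K: "compact_operator T" and \<delta>: "0 < \<delta>"
  obtains B where "orthonormal B" "B \<subseteq> M" "\<And>x. nA (T x - proj B (T x)) \<le> \<delta> * nA x"
proof -
  obtain c where c: "0 < c" "\<And>x. nA (T x) \<le> c * nA x" and bl: "bounded_linear T"
    using A_boundedE[OF T] by blast
  have lT: "linear T" using bl by (rule bounded_linear.linear)
  obtain k where k: "0 < k" "\<And>x. nA x \<le> k * norm x" using nA_le_norm by blast
  let ?C = "closure (T ` (ball_A A \<inter> M))"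
  have "compact ?C" using K bounded_ball by (simp add: compact_operator_def)
  then obtain F where F: "finite F" "?C \<subseteq> (\<Union>y\<in>F. ball y (\<delta> / k))"
    using compactE_image[of ?C ?C "\<lambda>y. ball y (\<delta> / k)"] \<delta> k(1)
    by (metis (no_types, lifting) UN_I centre_in_ball divide_pos_pos open_ball subsetI)
  \<comment> \<open>Net points need not lie in \<open>M\<close>, where Gram-Schmidt works, so they
    are replaced by representatives at A-distance 0.\<close>
  have "\<exists>m. m \<in> M \<and> nA (y - m) = 0" for y
    using split_kernel[of y] by blast
  then obtain p where p: "\<And>y. p y \<in> M" "\<And>y. nA (y - p y) = 0"
    by metis
  obtain B where B: "orthonormal B" "B \<subseteq> M" "p ` F \<subseteq> span B"
    using gram_schmidt_M[of "p ` F"] F(1) p(1) by auto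
  have unit: "nA (T x - proj B (T x)) \<le> \<delta>" if x: "x \<in> M" "nA x = 1" for x
  proof -
    have "T x \<in> ?C" using x by (intro subsetD[OF closure_subset] imageI) (simp add: ball_A_def)
    then obtain y where y: "y \<in> F" "norm (T x - y) < \<delta> / k"
      using F(2) by (auto simp: dist_norm norm_minus_commute)
    have "nA (T x - proj B (T x)) \<le> nA (T x - p y)"
      using B y(1) by (intro nA_residual_le_diff) auto
    also have "\<dots> = nA (T x - y)"
      by (rule nA_cong) (simp add: p(2))
    also have "\<dots> \<le> k * norm (T x - y)" by (rule k)
    also have "\<dots> \<le> \<delta>" using y(2) k(1) by (simp add: field_simps)
    finally show ?thesis .
  qed
  have "nA (T x - proj B (T x)) \<le> \<delta> * nA x" for x
  proof -
    obtain m where m: "m \<in> M" "nA (x - m) = 0" using split_kernel .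
    \<comment> \<open>\<open>T\<close> and \<open>proj B\<close> both preserve A-null vectors, so
      passing from \<open>x\<close> to \<open>m\<close> changes neither side of the
      estimate.\<close>
    have "nA (T (x - m)) = 0"
      using c(2)[of "x - m"] m(2) nA_ge_0[of "T (x - m)"] by simp
    then have "nA (T (x - m) - proj B (T (x - m))) = 0"
      using nA_residual_le[OF B(1), of "T (x - m)"] nA_ge_0 by (metis order_antisym)
    then have 1: "nA (T x - proj B (T x)) = nA (T m - proj B (T m))"
      by (intro nA_cong) (simp add: linear_diff[OF lT] linear_diff[OF linear_proj] algebra_simps)
    have 2: "nA x = nA m" using m(2) by (rule nA_cong)
    have "nA (T m - proj B (T m)) \<le> \<delta> * nA m"
    proof (cases "nA m = 0")
      case True
      then have "m = 0" using definite_M m(1) by blast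
      then show ?thesis by (simp add: linear_0[OF lT] linear_0[OF linear_proj] nA_zero)
    next
      case False
      then have pos: "0 < nA m" using nA_ge_0[of m] by simp
      let ?z = "(1 / nA m) *\<^sub>R m"
      have "nA (T ?z - proj B (T ?z)) \<le> \<delta>"
        using pos m(1) by (intro unit) (simp_all add: nA_scale subspace_scale[OF subspace_M])
      moreover have "T ?z - proj B (T ?z) = (1 / nA m) *\<^sub>R (T m - proj B (T m))"
        by (simp only: linear_scale[OF lT] linear_scale[OF linear_proj] scaleR_diff_right)
      ultimately have "(1 / nA m) * nA (T m - proj B (T m)) \<le> \<delta>"
        using pos by (simp only: nA_scale) simp
      then show ?thesis using pos by (simp add: field_simps)
    qed
    then show ?thesis using 1 2 by simp
  qed
  then show thesis using that B by blast
qed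

section \<open>The operator S that breaks approximate right symmetry\<close>

lemma not_right_symmetric:
  assumes T: "T \<in> A_bounded A" and K: "compact_operator T"
    and \<epsilon>: "0 \<le> \<epsilon>" "\<epsilon> < 1" and nz: "opnorm_A A T \<noteq> 0"
  shows "\<not> approx_right_symmetric \<epsilon> A T"
proof -
  obtain c0 where c0: "0 < c0" "\<And>x. nA (T x) \<le> c0 * nA x" and bl: "bounded_linear T"
    using A_boundedE[OF T] by blast
  have lT: "linear T" using bl by (rule bounded_linear.linear)
  define c where "c = opnorm_A A T"
  have Tc: "nA (T x) \<le> c * nA x" for x
    unfolding c_def using lT c0(2) by (rule opnorm_bound)
  \<comment> \<open>The vector \<open>w\<close> shows that the suprema range over nonempty sets, and
    it gives \<open>c\<close> the right sign.\<close>
  obtain w where w: "nA w = 1" using orthogonal_unit[of "{}"] by auto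
  have c: "0 < c"
    using Tc[of w] w nz nA_ge_0[of "T w"] by (simp add: c_def)
  \<comment> \<open>Thus \<open>\<epsilon> = 1 - 2 * t\<close>. With \<open>\<delta>\<close> as
    below, the two finite-rank approximation errors add up to \<open>c * t\<^sup>2\<close>, of
    second order in \<open>t\<close>.\<close>
  define t where "t = (1 - \<epsilon>) / 2"
  have t: "0 < t" "t \<le> 1/2" using \<epsilon> by (simp_all add: t_def)
  define \<delta> where "\<delta> = c * t\<^sup>2 / 2"
  have \<delta>: "0 < \<delta>" using c t by (simp add: \<delta>_def)
  obtain B where B: "orthonormal B" "B \<subseteq> M" "\<And>x. nA (T (x - proj B x)) \<le> \<delta> * nA x"
    using compact_approx_right[OF T K \<delta>] by blast
  obtain D where D: "orthonormal D" "D \<subseteq> M" "\<And>x. nA (T x - proj D (T x)) \<le> \<delta> * nA x"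
    using compact_approx_left[OF T K \<delta>] by blast
  define S1 where "S1 x = proj D (T (proj B x))" for x
  define S2 where "S2 x = (x - proj B x) - proj D (x - proj B x)" for x
  define S where "S x = S1 x + c *\<^sub>R S2 x" for x
  have bl1: "bounded_linear S1"
    unfolding S1_def
    by (intro bounded_linear_compose[OF bounded_linear_proj] bounded_linear_compose[OF bl] bounded_linear_proj)
  have bl2: "bounded_linear S2"
    unfolding S2_def
    by (intro bounded_linear_sub bounded_linear_ident bounded_linear_proj
        bounded_linear_compose[OF bounded_linear_proj])
  have blS: "bounded_linear S"
    unfolding S_def
    by (intro bounded_linear_add bl1 bounded_linear_const_scaleR bl2)
  \<comment> \<open>Pythagoras is used twice: in the target, where \<open>S1 x\<close> and
    \<open>S2 x\<close> are A-orthogonal, and in the source, where \<open>proj B x\<close> and its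
    residual are. General coefficients serve both \<open>S\<close> and the main part of
    \<open>T - t S\<close>.\<close>
  have comb: "nA (a *\<^sub>R S1 x + b *\<^sub>R S2 x) \<le> s * c * nA x"
    if ab: "\<bar>a\<bar> \<le> s" "\<bar>b\<bar> \<le> s * c" for a b s x
  proof (rule power2_le_imp_le)
    have s: "0 \<le> s" using ab by linarith
    have "ip (S2 x) (S1 x) = 0"
      unfolding S1_def S2_def by (rule ip_residual_proj[OF D(1)])
    then have "ip (a *\<^sub>R S1 x) (b *\<^sub>R S2 x) = 0"
      using ip_commute[of "S1 x" "S2 x"] by (simp add: ip_simps)
    then have "(nA (a *\<^sub>R S1 x + b *\<^sub>R S2 x))\<^sup>2 = (\<bar>a\<bar> * nA (S1 x))\<^sup>2 + (\<bar>b\<bar> * nA (S2 x))\<^sup>2"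
      by (simp add: pythagoras nA_scale)
    also have "\<dots> \<le> (s * (c * nA (proj B x)))\<^sup>2 + ((s * c) * nA (x - proj B x))\<^sup>2"
    proof (intro add_mono power_mono mult_mono ab s)
      show "nA (S1 x) \<le> c * nA (proj B x)"
        unfolding S1_def using nA_proj_le[OF D(1)] Tc order_trans by blast
      show "nA (S2 x) \<le> nA (x - proj B x)"
        unfolding S2_def by (rule nA_residual_le[OF D(1)])
    qed (use s c nA_ge_0 in auto)
    also have "\<dots> = (s * c)\<^sup>2 * ((nA (proj B x))\<^sup>2 + (nA (x - proj B x))\<^sup>2)"
      by (simp add: power_mult_distrib algebra_simps)
    also have "\<dots> = (s * c * nA x)\<^sup>2"
      by (simp add: nA_proj_sq[OF B(1), of x] power_mult_distrib)
    finally show "(nA (a *\<^sub>R S1 x + b *\<^sub>R S2 x))\<^sup>2 \<le> (s * c * nA x)\<^sup>2" .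
    show "0 \<le> s * c * nA x" using s c nA_ge_0 by simp
  qed
  have Sc: "nA (S x) \<le> c * nA x" for x
    using comb[of 1 1 c x] c by (simp add: S_def)
  have SA: "S \<in> A_bounded A" using blS Sc by (rule A_boundedI)
  have opS: "opnorm_A A S \<le> c" using w Sc by (rule opnorm_le)
  have op0: "0 \<le> opnorm_A A U" if "\<And>x. nA (U x) \<le> k * nA x" for U k
    using opnorm_ge_unit[OF that w] nA_ge_0[of "U w"] by linarith

  have "approx_orth \<epsilon> A S T"
    unfolding approx_orth_def
  proof
    fix l :: real
    let ?U = "\<lambda>x. S x + l *\<^sub>R T x"
    have Ub: "nA (?U x) \<le> (c + \<bar>l\<bar> * c) * nA x" for x
      using nA_triangle[of "S x" "l *\<^sub>R T x"] Sc[of x] mult_left_mono[OF Tc[of x], of "\<bar>l\<bar>"]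
      by (simp add: nA_scale algebra_simps)
    \<comment> \<open>Adding any multiple of \<open>T\<close> to \<open>S\<close> does not push the
      seminorm below \<open>c\<close>, so the orthogonality holds even without the error
      term.\<close>
    have "c \<le> opnorm_A A ?U"
    proof (rule field_le_epsilon)
      fix \<eta> :: real assume \<eta>: "0 < \<eta>"
      \<comment> \<open>Adding 1 to \<open>\<bar>l\<bar>\<close> avoids division by zero and still
        keeps the A-norm of \<open>l *\<^sub>R T x\<close> at most \<open>\<eta>\<close>.\<close>
      define \<eta>' where "\<eta>' = \<eta> / (\<bar>l\<bar> + 1)"
      have \<eta>': "0 < \<eta>'" using \<eta> by (simp add: \<eta>'_def)
      obtain Y where Y: "finite Y" "Y \<subseteq> M"
        "\<And>x. (\<And>y. y \<in> Y \<Longrightarrow> ip x y = 0) \<Longrightarrow> nA (T x) \<le> \<eta>' * nA x"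
        using compact_small_on_orthogonal[OF T K \<eta>'] by blast
      have fin: "finite (B \<union> D \<union> Y)" and sub: "B \<union> D \<union> Y \<subseteq> M"
        using B D Y by (auto simp: orthonormal_def)
      \<comment> \<open>Orthogonality to \<open>B\<close> and \<open>D\<close> gives
        \<open>S x = c *\<^sub>R x\<close>, and orthogonality to \<open>Y\<close> makes
        \<open>T x\<close> small.\<close>
      obtain x where x: "nA x = 1" "\<And>y. y \<in> B \<union> D \<union> Y \<Longrightarrow> ip x y = 0"
        using orthogonal_unit[OF fin sub] by blast
      have "proj B x = 0" "proj D x = 0" using x(2) by (auto intro: proj_eq_0)
      then have Sx: "S x = c *\<^sub>R x"
        by (simp add: S_def S1_def S2_def linear_0[OF lT] linear_0[OF linear_proj])
      have Tx: "nA (T x) \<le> \<eta>'" using Y(3)[of x] x by simp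
      have "c = nA (S x)" using Sx x(1) c by (simp add: nA_scale)
      also have "\<dots> \<le> nA (?U x) + nA (l *\<^sub>R T x)"
        using nA_diff_le[of "?U x" "l *\<^sub>R T x"] by simp
      also have "nA (l *\<^sub>R T x) \<le> (\<bar>l\<bar> + 1) * \<eta>'"
        unfolding nA_scale using Tx nA_ge_0 by (intro mult_mono) auto
      also have "(\<bar>l\<bar> + 1) * \<eta>' = \<eta>" by (simp add: \<eta>'_def)
      also have "nA (?U x) \<le> opnorm_A A ?U"
        using Ub x(1) by (rule opnorm_ge_unit)
      finally show "c \<le> opnorm_A A ?U + \<eta>" by simp
    qed
    then have "(opnorm_A A S)\<^sup>2 \<le> (opnorm_A A ?U)\<^sup>2"
      using opS op0[OF Sc] by (intro power_mono) auto
    moreover have "0 \<le> opnorm_A A (\<lambda>x. l *\<^sub>R T x)"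
      using mult_left_mono[OF Tc, of "\<bar>l\<bar>"] by (intro op0[of _ "\<bar>l\<bar> * c"]) (simp add: nA_scale mult.assoc)
    then have "0 \<le> 2 * \<epsilon> * opnorm_A A S * opnorm_A A (\<lambda>x. l *\<^sub>R T x)"
      using \<epsilon> op0[OF Sc] by simp
    ultimately show "(opnorm_A A S)\<^sup>2 - 2 * \<epsilon> * opnorm_A A S * opnorm_A A (\<lambda>x. l *\<^sub>R T x)
        \<le> (opnorm_A A ?U)\<^sup>2"
      by linarith
  qed
  moreover have "\<not> approx_orth \<epsilon> A T S"
  proof
    assume "approx_orth \<epsilon> A T S"
    \<comment> \<open>The scalar tested is \<open>-t\<close>.\<close>
    then have *: "c\<^sup>2 - 2 * \<epsilon> * c * opnorm_A A (\<lambda>x. (-t) *\<^sub>R S x)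
        \<le> (opnorm_A A (\<lambda>x. T x + (-t) *\<^sub>R S x))\<^sup>2"
      unfolding approx_orth_def c_def by blast
    let ?V = "\<lambda>x. T x + (-t) *\<^sub>R S x"
    have V: "nA (?V x) \<le> (c * (1 - t + t\<^sup>2)) * nA x" for x
    proof -
      \<comment> \<open>Here \<open>S1\<close> is subtracted from \<open>T\<close> in two stages:
        \<open>?p\<close> is the error of projecting after \<open>T\<close>, \<open>?q\<close> that
        of projecting before \<open>T\<close>. What remains, with \<open>-t *\<^sub>R S x\<close>,
        is \<open>?r\<close>.\<close>
      let ?p = "T x - proj D (T x)" and ?q = "proj D (T (x - proj B x))"
        and ?r = "(1 - t) *\<^sub>R S1 x + (- (t * c)) *\<^sub>R S2 x"
      have "?V x = (?p + ?q) + ?r"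
        by (simp add: S_def S1_def linear_diff[OF lT] linear_diff[OF linear_proj] algebra_simps)
      then have "nA (?V x) \<le> nA (?p + ?q) + nA ?r" by (simp only: nA_triangle)
      moreover have "nA (?p + ?q) \<le> nA ?p + nA ?q" by (rule nA_triangle)
      moreover have "nA ?p \<le> \<delta> * nA x" by (rule D)
      moreover have "nA ?q \<le> \<delta> * nA x" using nA_proj_le[OF D(1)] B(3) order_trans by blast
      \<comment> \<open>The bound \<open>t \<le> 1/2\<close> enters here: the coefficient of
        \<open>S2 x\<close> has modulus \<open>t * c\<close>, which must not exceed
        \<open>(1 - t) * c\<close>.\<close>
      moreover have "nA ?r \<le> (1 - t) * c * nA x"
        using t c by (intro comb) auto
      ultimately have "nA (?V x) \<le> \<delta> * nA x + \<delta> * nA x + (1 - t) * c * nA x" by linarith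
      then show ?thesis by (simp add: \<delta>_def algebra_simps)
    qed
    have "opnorm_A A ?V \<le> c * (1 - t + t\<^sup>2)"
      using w V by (rule opnorm_le)
    moreover have "0 \<le> opnorm_A A ?V" by (rule op0[OF V])
    ultimately have 1: "(opnorm_A A ?V)\<^sup>2 \<le> (c * (1 - t + t\<^sup>2))\<^sup>2" by (rule power_mono)
    have "opnorm_A A (\<lambda>x. (-t) *\<^sub>R S x) \<le> t * c"
    proof (rule opnorm_le[OF w])
      show "nA ((-t) *\<^sub>R S x) \<le> t * c * nA x" for x
        using mult_left_mono[OF Sc[of x], of t] t(1)
        by (simp add: nA_scale mult.assoc del: scaleR_minus_left)
    qed
    then have 2: "2 * \<epsilon> * c * opnorm_A A (\<lambda>x. (-t) *\<^sub>R S x) \<le> 2 * \<epsilon> * c * (t * c)"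
      using \<epsilon> c by (intro mult_left_mono) auto
    have "c\<^sup>2 * (1 - 2 * \<epsilon> * t) \<le> c\<^sup>2 * (1 - t + t\<^sup>2)\<^sup>2"
      using * 1 2 by (simp add: power_mult_distrib power2_eq_square algebra_simps)
    then have "1 - 2 * \<epsilon> * t \<le> (1 - t + t\<^sup>2)\<^sup>2" using c by simp
    moreover have "\<epsilon> = 1 - 2 * t" by (simp add: t_def field_simps)
    ultimately have "1 - 2 * (1 - 2 * t) * t \<le> (1 - t + t\<^sup>2)\<^sup>2" by simp
    \<comment> \<open>The constant and linear terms in \<open>t\<close> cancel; the quadratic term
      is 4 on the left against 3 on the right, which gives the contradiction.\<close>
    then have "t ^ 2 * (1 + 2 * t - t\<^sup>2) \<le> 0"
      by (simp add: power2_eq_square algebra_simps)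
    moreover have "0 < 1 + 2 * t - t\<^sup>2"
      using t mult_mono[of t "1/2" t "1/2"] by (simp add: power2_eq_square)
    ultimately show False using t by (simp add: mult_le_0_iff)
  qed
  ultimately show ?thesis using SA by (auto simp: approx_right_symmetric_def)
qed

end

theorem theorem3p7:
  fixes A T :: "'a::{real_inner, complete_space} \<Rightarrow> 'a" and \<epsilon> :: real
  assumes "separable_space (euclidean :: 'a topology)"
    and "infinite_dimensional (UNIV :: 'a set)"
    and "positive_operator A"
    and "bounded (ball_A A \<inter> closure (range A))"
    and "infinite_dimensional (closure (range A))"
    and "0 \<le> \<epsilon>" and "\<epsilon> < 1"
    and "T \<in> A_bounded A"
    and "compact_operator T"
  shows "approx_right_symmetric \<epsilon> A T \<longleftrightarrow> opnorm_A A T = 0"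
proof
  interpret positive_op_coercive A
    by unfold_locales (use assms in auto)
  show "opnorm_A A T = 0" if "approx_right_symmetric \<epsilon> A T"
    using not_right_symmetric assms that by blast
next
  assume "opnorm_A A T = 0"
  \<comment> \<open>When \<open>opnorm_A A T\<close> is 0, the lower bound required for
    orthogonality of \<open>T\<close> to \<open>S\<close> is 0, and the other side is a
    square.\<close>
  then show "approx_right_symmetric \<epsilon> A T"
    by (simp add: approx_right_symmetric_def approx_orth_def)
qed

end
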